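(* Under the TPE formulation for the objective and for each constraint, the expected constraint improvement satisfies $$\mathrm{ECI}_{f^\star}[\boldsymbol{x}\mid\boldsymbol{c}^\star,\mathcal{D}]\;\propto\;\prod_{i=0}^{C} r_i^{\mathrm{rel}}(\boldsymbol{x}\mid\mathcal{D}),$$ i.e. there is a positive finite constant $K$, independent of $\boldsymbol{x}$, such that $\mathrm{ECI}_{f^\star}[\boldsymbol{x}\mid\boldsymbol{c}^\star,\mathcal{D}]=K\prod_{i=0}^{C}r_i^{\mathrm{rel}}(\boldsymbol{x}\mid\mathcal{D})$ for all $\boldsymbol{x}\in\mathcal{X}$.
   Context: Setting: $\mathcal{X}\subseteq\mathbb{R}^D$ is a compact measurable search space, $f$ is an objective on $\mathcal{X}$ to be minimized and $c_1,\dots,c_C$ are constraint functions on $\mathcal{X}$ with thresholds $\boldsymbol{c}^\star=[c_1^\star,\dots,c_C^\star]\in\mathbb{R}^C$ (the constraints are $c_i(\boldsymbol{x})\le c_i^\star$). $\mathcal{D}=\{(\boldsymbol{x}_n,f_n,\boldsymbol{c}_n)\}_{n=1}^N$ is a fixed finite set of observations and $f^\star\in\mathbb{R}$ is a fixed objective threshold. Write $c_0:=f$ and $c_0^\star:=f^\star$. For $i\in\{0,\dots,C\}$, $\mathcal{D}$ is split into $\mathcal{D}_i^{(l)}$ (observations whose $i$-th value is $\le c_i^\star$; nonempty) and $\mathcal{D}_i^{(g)}$ (the rest), and $\hat\gamma_i:=|\mathcal{D}_i^{(l)}|/|\mathcal{D}|\in(0,1]$. TPE formulation for metric $i\in\{0,\dots,C\}$: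 $p(\cdot\mid\mathcal{D}_i^{(l)})$, $p(\cdot\mid\mathcal{D}_i^{(g)})$ are strictly positive probability densities on $\mathcal{X}$ (kernel density estimators) and $$p(\boldsymbol{x}\mid c_i,\mathcal{D})=\begin{cases}p(\boldsymbol{x}\mid\mathcal{D}_i^{(l)}) & (c_i\le c_i^\star)\\ p(\boldsymbol{x}\mid\mathcal{D}_i^{(g)}) & (c_i>c_i^\star).\end{cases}$$ $p(c_i\mid\mathcal{D})$ is a probability density on $\mathbb{R}$ with $\int_{-\infty}^{c_i^\star}p(c_i\mid\mathcal{D})\,dc_i=\hat\gamma_i$ and finite first moment; and, within the model of metric $i$, by Bayes' theorem $p(c_i\mid\boldsymbol{x},\mathcal{D})=p(\boldsymbol{x}\mid c_i,\mathcal{D})\,p(c_i\mid\mathcal{D})/p(\boldsymbol{x}\mid\mathcal{D})$ with $p(\boldsymbol{x}\mid\mathcal{D})=\int p(\boldsymbol{x}\mid c_i,\mathcal{D})\,p(c_i\mid\mathcal{D})\,dc_i=\hat\gamma_i\,p(\boldsymbol{x}\mid\mathcal{D}_i^{(l)})+(1-\hat\gamma_i)\,p(\boldsymbol{x}\mid\mathcal{D}_i^{(g)})$. Density ratio and relative density ratio: $$r_i(\boldsymbol{x}\mid\mathcal{D}):=\frac{p(\boldsymbol{x}\mid\mathcal{D}_i^{(l)})}{p(\boldsymbol{x}\mid\mathcal{D}_i^{(g)})},\qquad r_i^{\mathrm{rel}}(\boldsymbol{x}\mid\mathcal{D}):=\bigl(\hat\gamma_i+(1-\hat\gamma_i)\,r_i(\boldsymbol{x}\mid\mathcal{D})^{-1}\bigr)^{-1},$$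 with $r_i^{\mathrm{rel}}=1$ when $\hat\gamma_i=1$ (i.e. $\mathcal{D}_i^{(g)}=\emptyset$; in that case the terms involving $p(\cdot\mid\mathcal{D}_i^{(g)})$ are dropped). Acquisition functions: $\mathrm{EI}_{f^\star}[\boldsymbol{x}\mid\mathcal{D}]=\int_{-\infty}^{f^\star}(f^\star-f)\,p(f\mid\boldsymbol{x},\mathcal{D})\,df$, $\mathbb{P}(c_i\le c_i^\star\mid\boldsymbol{x},\mathcal{D})=\int_{-\infty}^{c_i^\star}p(c_i\mid\boldsymbol{x},\mathcal{D})\,dc_i$, and the expected constraint improvement is (in factorized form) $$\mathrm{ECI}_{f^\star}[\boldsymbol{x}\mid\boldsymbol{c}^\star,\mathcal{D}]=\mathrm{EI}_{f^\star}[\boldsymbol{x}\mid\mathcal{D}]\prod_{i=1}^{C}\mathbb{P}(c_i\le c_i^\star\mid\boldsymbol{x},\mathcal{D}).$$ *)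

theory Defs
  imports "HOL-Analysis.Analysis" "HOL-Library.Multiset"
begin

text \<open>
  An observation is a triple \<open>(x, f, c)\<close>; the constraint values are the entries
  \<open>c 1, \<dots>, c C\<close> of the third component.  A data set is a finite multiset of observations,
  so repeated observations are counted with multiplicity.
\<close>

type_synonym 'd observation = "(real ^ 'd) \<times> real \<times> (nat \<Rightarrow> real)"

text \<open>The objective is metric \<open>0\<close>: \<open>c\<^sub>0 = f\<close> and \<open>c\<^sub>0\<^sup>\<star> = f\<^sup>\<star>\<close>.\<close>

definition metric_value :: "nat \<Rightarrow> 'd observation \<Rightarrow> real" where
  "metric_value i obs = (case obs of (x, f, c) \<Rightarrow> if i = 0 then f else c i)"

definition threshold :: "real \<Rightarrow> (nat \<Rightarrow> real) \<Rightarrow> nat \<Rightarrow> real" where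
  "threshold fstar cstar i = (if i = 0 then fstar else cstar i)"

text \<open>From here on, \<open>t\<close> is the family of thresholds of all metrics, objective included.\<close>

definition lower_data ::
    "'d observation multiset \<Rightarrow> (nat \<Rightarrow> real) \<Rightarrow> nat \<Rightarrow> 'd observation multiset" where
  "lower_data D t i = {# obs \<in># D. metric_value i obs \<le> t i #}"

definition upper_data ::
    "'d observation multiset \<Rightarrow> (nat \<Rightarrow> real) \<Rightarrow> nat \<Rightarrow> 'd observation multiset" where
  "upper_data D t i = {# obs \<in># D. metric_value i obs > t i #}"

definition gamma_hat :: "'d observation multiset \<Rightarrow> (nat \<Rightarrow> real) \<Rightarrow> nat \<Rightarrow> real" where
  "gamma_hat D t i = real (size (lower_data D t i)) / real (size D)"

definition prob_density_on :: "'a::euclidean_space set \<Rightarrow> ('a \<Rightarrow> real) \<Rightarrow> bool" where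
  "prob_density_on S p \<longleftrightarrow>
     set_integrable lborel S p \<and> (\<forall>x\<in>S. 0 \<le> p x) \<and> (LINT x:S|lborel. p x) = 1"

text \<open>
  \<open>dens i E\<close> is the density \<open>p(\<cdot> | E)\<close> which the estimator used for metric \<open>i\<close> assigns to the
  data \<open>E\<close>, and \<open>prior i\<close> is the density \<open>p(c\<^sub>i | D)\<close> for the data set \<open>D\<close> at hand.
\<close>

type_synonym 'd estimator = "nat \<Rightarrow> 'd observation multiset \<Rightarrow> real ^ 'd \<Rightarrow> real"

text \<open>
  \<open>p(x | c\<^sub>i, D)\<close>.  If \<open>upper_data D t i\<close> is empty, the value of the second branch is
  irrelevant: \<open>prior i\<close> then has total mass \<open>gamma_hat D t i = 1\<close> on \<open>{..t i}\<close>, so it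
  vanishes almost everywhere on the range of that branch.
\<close>

definition likelihood ::
    "'d estimator \<Rightarrow> 'd observation multiset \<Rightarrow> (nat \<Rightarrow> real) \<Rightarrow> nat \<Rightarrow> real ^ 'd \<Rightarrow> real \<Rightarrow> real" where
  "likelihood dens D t i x c =
     (if c \<le> t i then dens i (lower_data D t i) x else dens i (upper_data D t i) x)"

text \<open>\<open>p(x | D)\<close> within the model of metric \<open>i\<close>.\<close>

definition evidence ::
    "'d estimator \<Rightarrow> (nat \<Rightarrow> real \<Rightarrow> real) \<Rightarrow> 'd observation multiset \<Rightarrow> (nat \<Rightarrow> real) \<Rightarrow> nat
      \<Rightarrow> real ^ 'd \<Rightarrow> real" where
  "evidence dens prior D t i x = (LINT c|lborel. likelihood dens D t i x c * prior i c)"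

text \<open>\<open>p(c\<^sub>i | x, D)\<close>, by Bayes' theorem.\<close>

definition posterior ::
    "'d estimator \<Rightarrow> (nat \<Rightarrow> real \<Rightarrow> real) \<Rightarrow> 'd observation multiset \<Rightarrow> (nat \<Rightarrow> real) \<Rightarrow> nat
      \<Rightarrow> real ^ 'd \<Rightarrow> real \<Rightarrow> real" where
  "posterior dens prior D t i x c =
     likelihood dens D t i x c * prior i c / evidence dens prior D t i x"

definition density_ratio ::
    "'d estimator \<Rightarrow> 'd observation multiset \<Rightarrow> (nat \<Rightarrow> real) \<Rightarrow> nat \<Rightarrow> real ^ 'd \<Rightarrow> real" where
  "density_ratio dens D t i x = dens i (lower_data D t i) x / dens i (upper_data D t i) x"

definition rel_density_ratio ::
    "'d estimator \<Rightarrow> 'd observation multiset \<Rightarrow> (nat \<Rightarrow> real) \<Rightarrow> nat \<Rightarrow> real ^ 'd \<Rightarrow> real" where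
  "rel_density_ratio dens D t i x =
     (if gamma_hat D t i = 1 then 1
      else inverse (gamma_hat D t i
                    + (1 - gamma_hat D t i) * inverse (density_ratio dens D t i x)))"

definition expected_improvement ::
    "'d estimator \<Rightarrow> (nat \<Rightarrow> real \<Rightarrow> real) \<Rightarrow> 'd observation multiset \<Rightarrow> (nat \<Rightarrow> real)
      \<Rightarrow> real ^ 'd \<Rightarrow> real" where
  "expected_improvement dens prior D t x =
     (LINT f:{..t 0}|lborel. (t 0 - f) * posterior dens prior D t 0 x f)"

definition feasibility_prob ::
    "'d estimator \<Rightarrow> (nat \<Rightarrow> real \<Rightarrow> real) \<Rightarrow> 'd observation multiset \<Rightarrow> (nat \<Rightarrow> real) \<Rightarrow> nat
      \<Rightarrow> real ^ 'd \<Rightarrow> real" where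
  "feasibility_prob dens prior D t i x =
     (LINT c:{..t i}|lborel. posterior dens prior D t i x c)"

definition expected_constraint_improvement ::
    "'d estimator \<Rightarrow> (nat \<Rightarrow> real \<Rightarrow> real) \<Rightarrow> 'd observation multiset \<Rightarrow> (nat \<Rightarrow> real) \<Rightarrow> nat
      \<Rightarrow> real ^ 'd \<Rightarrow> real" where
  "expected_constraint_improvement dens prior D t C x =
     expected_improvement dens prior D t x * (\<Prod>i=1..C. feasibility_prob dens prior D t i x)"

end

theory Submission
  imports Defs
begin

text \<open>
  On the half line \<open>{..t i}\<close> the likelihood does not depend on \<open>c\<close>, and its quotient by the
  evidence is exactly the relative density ratio.  Both acquisition factors are therefore the
  relative density ratio times an integral of the prior alone; that integral is
  \<open>gamma_hat D t i\<close> for a constraint, and \<open>\<integral> (t 0 - f) prior 0 f df\<close> over \<open>{..t 0}\<close> for the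
  objective, which is positive because the prior has mass on \<open>{..t 0}\<close> and the single point
  \<open>t 0\<close> is negligible.
\<close>

lemma prob_density_on_UNIV:
  assumes "prob_density_on UNIV p"
  shows "integrable lborel p" "\<And>x. 0 \<le> p x" "integral\<^sup>L lborel p = 1"
  using assms by (auto simp: prob_density_on_def set_integrable_def set_lebesgue_integral_def)

lemma gamma_hat_pos:
  assumes "lower_data D t i \<noteq> {#}"
  shows "0 < gamma_hat D t i"
proof -
  have "D \<noteq> {#}"
    using assms by (auto simp: lower_data_def)
  then show ?thesis
    using assms by (simp add: gamma_hat_def nonempty_has_size)
qed

text \<open>No condition is placed on the densities, so the formula also covers an empty upper data
  set: for \<open>gamma_hat D t i = 1\<close> the arbitrary upper value gets weight 0.\<close>

lemma evidence_eq:
  assumes "integrable lborel (prior i)" "integral\<^sup>L lborel (prior i) = 1"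
    and "(LINT c:{..t i}|lborel. prior i c) = gamma_hat D t i"
  shows "evidence dens prior D t i x =
    gamma_hat D t i * dens i (lower_data D t i) x
      + (1 - gamma_hat D t i) * dens i (upper_data D t i) x"
proof -
  let ?l = "dens i (lower_data D t i) x" and ?u = "dens i (upper_data D t i) x"
  let ?p = "\<lambda>c. indicator {..t i} c * prior i c"
  have int: "integrable lborel ?p"
    using integrable_mult_indicator[OF _ assms(1), of "{..t i}"] by simp
  \<comment> \<open>The two-valued likelihood is the constant \<open>?u\<close> plus the jump
    \<open>?l - ?u\<close> on the half line, which leaves only the total mass of the prior and its
    mass below the threshold.\<close>
  have "evidence dens prior D t i x = (LINT c|lborel. (?l - ?u) * ?p c + ?u * prior i c)"
    unfolding evidence_def likelihood_def
    by (intro Bochner_Integration.integral_cong) (auto simp: algebra_simps)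
  also have "\<dots> = (?l - ?u) * gamma_hat D t i + ?u"
    using assms int by (simp add: set_lebesgue_integral_def)
  finally show ?thesis
    by (simp add: algebra_simps)
qed

text \<open>
  If \<open>gamma_hat D t i = 1\<close>, the upper density is multiplied by \<open>0\<close> in the evidence; otherwise
  \<open>inverse (l / u) = u / l\<close> holds even for \<open>u = 0\<close>.
\<close>

lemma lower_density_div_evidence:
  assumes "integrable lborel (prior i)" "integral\<^sup>L lborel (prior i) = 1"
    and "(LINT c:{..t i}|lborel. prior i c) = gamma_hat D t i"
    and "dens i (lower_data D t i) x \<noteq> 0"
  shows "dens i (lower_data D t i) x / evidence dens prior D t i x
    = rel_density_ratio dens D t i x"
proof (cases "gamma_hat D t i = 1")
  case True
  then show ?thesis
    using assms by (simp add: evidence_eq rel_density_ratio_def)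
next
  case False
  let ?g = "gamma_hat D t i"
  let ?l = "dens i (lower_data D t i) x" and ?u = "dens i (upper_data D t i) x"
  have "?g + (1 - ?g) * inverse (?l / ?u) = (?g * ?l + (1 - ?g) * ?u) / ?l"
    using assms(4) by (simp add: field_simps)
  then show ?thesis
    using False by (simp add: evidence_eq[where prior=prior and i=i, OF assms(1-3)]
        rel_density_ratio_def density_ratio_def)
qed

lemma posterior_lower:
  assumes "integrable lborel (prior i)" "integral\<^sup>L lborel (prior i) = 1"
    and "(LINT c:{..t i}|lborel. prior i c) = gamma_hat D t i"
    and "dens i (lower_data D t i) x \<noteq> 0"
    and "c \<le> t i"
  shows "posterior dens prior D t i x c = rel_density_ratio dens D t i x * prior i c"
  \<comment> \<open>Read from right to left, the quotient lemma turns the relative ratio back into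
    lower density over evidence, which is the shape of the unfolded posterior.\<close>
  using assms(5) by (simp add: posterior_def likelihood_def
      flip: lower_density_div_evidence[where prior=prior and i=i and dens=dens, OF assms(1-4)])

lemma feasibility_prob_eq:
  assumes "integrable lborel (prior i)" "integral\<^sup>L lborel (prior i) = 1"
    and "(LINT c:{..t i}|lborel. prior i c) = gamma_hat D t i"
    and "dens i (lower_data D t i) x \<noteq> 0"
  shows "feasibility_prob dens prior D t i x = gamma_hat D t i * rel_density_ratio dens D t i x"
proof -
  have "feasibility_prob dens prior D t i x
      = (LINT c:{..t i}|lborel. rel_density_ratio dens D t i x * prior i c)"
    unfolding feasibility_prob_def
    by (rule set_lebesgue_integral_cong)
      (auto simp: posterior_lower[where prior=prior and dens=dens and i=i, OF assms])
  then show ?thesis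
    using assms(3) by simp
qed

lemma expected_improvement_eq:
  assumes "integrable lborel (prior 0)" "integral\<^sup>L lborel (prior 0) = 1"
    and "(LINT c:{..t 0}|lborel. prior 0 c) = gamma_hat D t 0"
    and "dens 0 (lower_data D t 0) x \<noteq> 0"
  shows "expected_improvement dens prior D t x
    = (LINT f:{..t 0}|lborel. (t 0 - f) * prior 0 f) * rel_density_ratio dens D t 0 x"
proof -
  have "expected_improvement dens prior D t x
      = (LINT f:{..t 0}|lborel. rel_density_ratio dens D t 0 x * ((t 0 - f) * prior 0 f))"
    unfolding expected_improvement_def
    by (rule set_lebesgue_integral_cong)
      (auto simp: posterior_lower[where prior=prior and dens=dens and i=0, OF assms])
  then show ?thesis
    by simp
qed

text \<open>The integrand is nonnegative, so a zero integral would force it, and hence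
  \<open>p\<close>, to vanish almost everywhere on the half line, against the positive mass
  there.\<close>

lemma mean_improvement_pos:
  fixes p :: "real \<Rightarrow> real"
  assumes int: "integrable lborel p" "integrable lborel (\<lambda>c. c * p c)"
    and nonneg: "\<And>c. 0 \<le> p c"
    and mass: "0 < (LINT c:{..a}|lborel. p c)"
  shows "0 < (LINT c:{..a}|lborel. (a - c) * p c)"
proof -
  let ?h = "\<lambda>c. indicator {..a} c * ((a - c) * p c)"
  \<comment> \<open>This is where the finite first moment enters. A non-integrable function has
    Bochner integral 0 by convention, so a zero integral would imply nothing about \<open>?h\<close>
    without integrability.\<close>
  have "integrable lborel (\<lambda>c. a * p c - c * p c)"
    using int by simp
  then have int_h: "integrable lborel ?h"
    using integrable_mult_indicator[of "{..a}" lborel "\<lambda>c. (a - c) * p c"]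
    by (simp add: left_diff_distrib)
  have h_nonneg: "0 \<le> ?h c" for c
    using nonneg[of c] by (simp add: indicator_def)
  have "integral\<^sup>L lborel ?h \<noteq> 0"
  proof
    assume "integral\<^sup>L lborel ?h = 0"
    then have "AE c in lborel. ?h c = 0"
      using integral_nonneg_eq_0_iff_AE[OF int_h] h_nonneg by simp
    moreover have "AE c in lborel. c \<noteq> a"
      by (rule AE_lborel_singleton)
    \<comment> \<open>Away from the null point \<open>a\<close>, the factor \<open>a - c\<close> is
      nonzero and cancels from \<open>?h c = 0\<close>.\<close>
    ultimately have "AE c in lborel. indicator {..a} c * p c = 0"
      by eventually_elim (auto simp: indicator_def split: if_splits)
    then have "(LINT c:{..a}|lborel. p c) = 0"
      unfolding set_lebesgue_integral_def by (intro integral_eq_zero_AE) simp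
    with mass show False
      by simp
  qed
  moreover have "0 \<le> integral\<^sup>L lborel ?h"
    by (intro Bochner_Integration.integral_nonneg) (rule h_nonneg)
  ultimately show ?thesis
    by (simp add: set_lebesgue_integral_def)
qed

theorem corollary1:
  fixes X :: "(real ^ 'd) set"
    and D :: "'d observation multiset"
    and C :: nat
    and fstar :: real
    and cstar :: "nat \<Rightarrow> real"
    and dens :: "'d estimator"
    and prior :: "nat \<Rightarrow> real \<Rightarrow> real"
  defines "t \<equiv> threshold fstar cstar"
  assumes "compact X" and "X \<in> sets borel"
    and "\<And>x f c. (x, f, c) \<in># D \<Longrightarrow> x \<in> X"
    and lower_nonempty: "\<And>i. i \<le> C \<Longrightarrow> lower_data D t i \<noteq> {#}"
    and lower_density: "\<And>i. i \<le> C \<Longrightarrow> prob_density_on X (dens i (lower_data D t i))"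
    and lower_pos: "\<And>i x. i \<le> C \<Longrightarrow> x \<in> X \<Longrightarrow> 0 < dens i (lower_data D t i) x"
    and upper_density: "\<And>i. i \<le> C \<Longrightarrow> upper_data D t i \<noteq> {#} \<Longrightarrow>
          prob_density_on X (dens i (upper_data D t i))"
    and upper_pos: "\<And>i x. i \<le> C \<Longrightarrow> upper_data D t i \<noteq> {#} \<Longrightarrow> x \<in> X \<Longrightarrow>
          0 < dens i (upper_data D t i) x"
    and prior_density: "\<And>i. i \<le> C \<Longrightarrow> prob_density_on UNIV (prior i)"
    and prior_quantile: "\<And>i. i \<le> C \<Longrightarrow>
          (LINT c:{..t i}|lborel. prior i c) = gamma_hat D t i"
    and prior_moment: "\<And>i. i \<le> C \<Longrightarrow> integrable lborel (\<lambda>c. c * prior i c)"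
  shows "\<exists>K>0. \<forall>x\<in>X. expected_constraint_improvement dens prior D t C x
           = K * (\<Prod>i=0..C. rel_density_ratio dens D t i x)"
proof -
  note prior = prob_density_on_UNIV[OF prior_density]
  let ?A = "LINT f:{..t 0}|lborel. (t 0 - f) * prior 0 f"
  \<comment> \<open>\<open>?K\<close> collects what is left of each factor once its relative ratio
    is removed: \<open>?A\<close> from the objective and \<open>gamma_hat D t i\<close> from each
    constraint. None of these depends on \<open>x\<close>.\<close>
  let ?K = "?A * (\<Prod>i=1..C. gamma_hat D t i)"
  have "0 < ?A"
    using prior(1)[of 0] prior_moment[of 0] prior(2)[of 0] prior_quantile[of 0]
      gamma_hat_pos[OF lower_nonempty[of 0]]
    by (intro mean_improvement_pos) auto
  moreover have "0 < (\<Prod>i=1..C. gamma_hat D t i)"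
    by (intro prod_pos) (simp add: gamma_hat_pos lower_nonempty)
  ultimately have "0 < ?K"
    by simp
  moreover have "expected_constraint_improvement dens prior D t C x
      = ?K * (\<Prod>i=0..C. rel_density_ratio dens D t i x)" if "x \<in> X" for x
  proof -
    have pos: "dens i (lower_data D t i) x \<noteq> 0" if "i \<le> C" for i
      using lower_pos[OF that \<open>x \<in> X\<close>] by simp
    have "expected_improvement dens prior D t x = ?A * rel_density_ratio dens D t 0 x"
      by (intro expected_improvement_eq prior prior_quantile pos) simp_all
    moreover have "(\<Prod>i=1..C. feasibility_prob dens prior D t i x)
        = (\<Prod>i=1..C. gamma_hat D t i * rel_density_ratio dens D t i x)"
      by (intro prod.cong refl feasibility_prob_eq prior prior_quantile pos) simp_all
    \<comment> \<open>Index 0 is split off because its ratio comes from the expected improvement,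
      the others from the feasibility probabilities.\<close>
    moreover have "(\<Prod>i=0..C. rel_density_ratio dens D t i x)
        = rel_density_ratio dens D t 0 x * (\<Prod>i=1..C. rel_density_ratio dens D t i x)"
      by (simp add: prod.atLeast_Suc_atMost)
    ultimately show ?thesis
      by (simp add: expected_constraint_improvement_def prod.distrib mult_ac)
  qed
  ultimately show ?thesis
    by blast
qed

end
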